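(* Let $D=(V,E)$ be a finite strongly connected $d$-regular digraph of order $n\ge 2$ with $V\subset\mathbb{C}$. Then there exists a polynomial $\Phi(x,y)\in\mathbb{C}[x,y]$ such that $D$ is a strong component of $G(\Phi)$.
   Context: Digraphs may be infinite and may have loops and multiple arcs. A digraph is $d$-regular if every vertex has indegree $d$ and outdegree $d$ (counting multiplicities of arcs). The strong component of a vertex $u$ in a digraph is the subdigraph induced by $u$ and all vertices $v$ such that there is a directed path from $u$ to $v$ and a directed path from $v$ to $u$ (arcs keep their multiplicities). For $\Phi(x,y)\in\mathbb{C}[x,y]$, the digraph $G(\Phi)$ has vertex set $\mathbb{C}$, and the ordered pair $(u,v)$ is an arc of multiplicity $m\ge 1$ if $v$ is a root of multiplicity $m$ of the univariate polynomial $\Phi(u,y)$; if $\Phi(u,y)$ is the zero polynomial for some $u$, then every $(u,v)$, $v\in\mathbb{C}$, is an arc of multiplicity $1$. *)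

theory Defs
  imports
    "Graph_Theory.Digraph_Component"
    "HOL-Computational_Algebra.Polynomial"
    Complex_Main
begin

(* card is 0 on infinite sets, so finiteness is required explicitly. *)
definition regular_digraph :: "nat \<Rightarrow> ('a, 'b) pre_digraph \<Rightarrow> bool" where
  "regular_digraph d G \<longleftrightarrow>
     (\<forall>v \<in> verts G. finite (in_arcs G v) \<and> in_degree G v = d \<and>
                    finite (out_arcs G v) \<and> out_degree G v = d)"

definition strong_component :: "('a, 'b) pre_digraph \<Rightarrow> 'a \<Rightarrow> ('a, 'b) pre_digraph" where
  "strong_component G u = G \<restriction> pre_digraph.scc_of G u"

(* Equality of digraphs up to the names of the arcs: the vertices coincide, and
   each ordered pair of vertices has the same multiplicity in both. *)
definition same_digraph :: "('a, 'b) pre_digraph \<Rightarrow> ('a, 'c) pre_digraph \<Rightarrow> bool" where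
  "same_digraph G H \<longleftrightarrow>
     verts G = verts H \<and>
     (\<exists>f. bij_betw f (arcs G) (arcs H) \<and>
          (\<forall>e \<in> arcs G. tail H (f e) = tail G e \<and> head H (f e) = head G e))"

definition is_strong_component :: "('a, 'b) pre_digraph \<Rightarrow> ('a, 'c) pre_digraph \<Rightarrow> bool" where
  "is_strong_component D G \<longleftrightarrow> (\<exists>u \<in> verts G. same_digraph D (strong_component G u))"

(* A bivariate polynomial Phi(x, y) is a polynomial in x with coefficients in C[y];
   hence Phi(u, y) is poly Phi [:u:]. *)
definition arc_mult :: "complex poly poly \<Rightarrow> complex \<Rightarrow> complex \<Rightarrow> nat" where
  "arc_mult \<Phi> u v =
     (if poly \<Phi> [:u:] = 0 then 1 else order v (poly \<Phi> [:u:]))"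

(* The arc (u, v, i) is the i-th parallel arc from u to v. *)
definition poly_digraph :: "complex poly poly \<Rightarrow> (complex, complex \<times> complex \<times> nat) pre_digraph" where
  "poly_digraph \<Phi> =
     \<lparr> verts = UNIV,
       arcs = {(u, v, i). i < arc_mult \<Phi> u v},
       tail = (\<lambda>(u, v, i). u),
       head = (\<lambda>(u, v, i). v) \<rparr>"

end

theory Submission
  imports Defs
begin

text \<open>
  Write \<open>V\<close> for the vertex set of \<open>D\<close> and \<open>m(u, v)\<close> for the number of arcs from \<open>u\<close> to \<open>v\<close>.
  The polynomials \<open>P\<^sub>u(y) = \<Prod>\<^sub>v (y - v)\<^bsup>m(u,v)\<^esup>\<close> prescribe exactly the arcs
  leaving \<open>u\<close>, and since \<open>V\<close> is finite, Lagrange interpolation in \<open>x\<close> with coefficients in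
  \<open>\<complex>[y]\<close> gives one \<open>\<Phi>\<close> with \<open>\<Phi>(u, y) = P\<^sub>u(y)\<close> for all \<open>u \<in> V\<close>
  (\<open>interpolation_in_outer_variable\<close>).

  Because \<open>P\<^sub>u\<close> is nonzero and has all its roots in \<open>V\<close>, no arc of \<open>G(\<Phi>)\<close> leaves \<open>V\<close>:
  whatever is reachable from \<open>V\<close> already lies in \<open>V\<close>. Conversely \<open>G(\<Phi>)\<close> contains the arcs of
  \<open>D\<close>, which connect any two vertices of \<open>V\<close>. So \<open>V\<close> is a whole strong component
  (\<open>scc_of_closed_set\<close>), however \<open>\<Phi>(x, y)\<close> behaves for \<open>x\<close> outside \<open>V\<close>. Inside \<open>V\<close> the
  multiplicities agree by the choice of \<open>P\<^sub>u\<close>, and equal multiplicities suffice for the two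
  digraphs to coincide up to the names of the arcs (\<open>same_digraph_poly_digraphI\<close>).
\<close>

text \<open>
  The polynomials \<open>\<Prod>\<^bsub>w \<noteq> u\<^esub> (x - w)\<close> vanish at all points of \<open>V\<close> except \<open>u\<close>, where the
  value is a nonzero constant of the field; it is therefore invertible even in the coefficient
  ring \<open>K[y]\<close>, and no division of polynomials occurs.
\<close>

lemma interpolation_in_outer_variable:
  fixes P :: "'a::field \<Rightarrow> 'a poly"
  assumes "finite V"
  shows "\<exists>\<Phi> :: 'a poly poly. \<forall>u\<in>V. poly \<Phi> [:u:] = P u"
proof -
  define c where "c u = (\<Prod>w\<in>V - {u}. u - w)" for u
  define L :: "'a \<Rightarrow> 'a poly poly" where "L u = (\<Prod>w\<in>V - {u}. [:-[:w:], 1:])" for u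
  define \<Phi> where "\<Phi> = (\<Sum>u\<in>V. smult (P u * [:inverse (c u):]) (L u))"
  have const_prod: "(\<Prod>w\<in>A. [:f w:]) = [:\<Prod>w\<in>A. f w:]" for A and f :: "'a \<Rightarrow> 'a"
    by (induction A rule: infinite_finite_induct) (auto simp: one_pCons)
  have L_eval: "poly (L u) [:t:] = [:\<Prod>w\<in>V - {u}. t - w:]" for u t
    by (simp add: L_def poly_prod const_prod)
  have L_other: "poly (L u) [:t:] = 0" if "t \<in> V" "u \<noteq> t" for u t
    using that assms by (auto simp: L_eval)
  have c_nonzero: "c u \<noteq> 0" for u
    using assms by (auto simp: c_def)
  have "poly \<Phi> [:t:] = P t" if "t \<in> V" for t
  proof -
    have "poly \<Phi> [:t:] = (\<Sum>u\<in>V. P u * [:inverse (c u):] * poly (L u) [:t:])"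
      by (simp add: \<Phi>_def poly_sum)
    also have "\<dots> = (\<Sum>u\<in>{t}. P u * [:inverse (c u):] * poly (L u) [:t:])"
      using that assms L_other by (intro sum.mono_neutral_right) auto
    also have "\<dots> = P t * ([:inverse (c t):] * [:c t:])"
      by (simp add: L_eval c_def mult.assoc)
    also have "\<dots> = P t"
      using c_nonzero[of t] by simp
    finally show ?thesis .
  qed
  then show ?thesis by blast
qed

lemma order_prod_linear_factors:
  fixes f :: "'b \<Rightarrow> 'a::idom"
  assumes "finite A"
  shows "order v (\<Prod>a\<in>A. [:- f a, 1:]) = card {a \<in> A. f a = v}"
  using assms
proof (induction A rule: finite_induct)
  case empty
  then show ?case by simp
next
  case (insert a A)
  have "order v [:- f a, 1:] = (if f a = v then 1 else 0)"
    using order_power_n_n[of v 1] by (auto intro: order_0I)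
  moreover have "[:- f a, 1:] * (\<Prod>a\<in>A. [:- f a, 1:]) \<noteq> 0"
    using insert.hyps by (simp del: mult_pCons_left)
  moreover have "{b \<in> insert a A. f b = v} =
      (if f a = v then insert a {b \<in> A. f b = v} else {b \<in> A. f b = v})"
    by auto
  ultimately show ?case
    using insert by (simp add: order_mult del: mult_pCons_left)
qed

lemma wf_digraph_poly_digraph: "wf_digraph (poly_digraph \<Phi>)"
  by unfold_locales (auto simp: poly_digraph_def)

lemma poly_digraph_dominates_iff:
  "u \<rightarrow>\<^bsub>poly_digraph \<Phi>\<^esub> v \<longleftrightarrow> arc_mult \<Phi> u v > 0"
  by (force simp: arcs_ends_conv poly_digraph_def image_iff)

lemma scc_of_closed_set:
  fixes G :: "('a, 'b) pre_digraph"
  assumes "wf_digraph G"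
    and closed: "\<And>u v. u \<in> S \<Longrightarrow> u \<rightarrow>\<^bsub>G\<^esub> v \<Longrightarrow> v \<in> S"
    and connected: "\<And>u v. u \<in> S \<Longrightarrow> v \<in> S \<Longrightarrow> u \<rightarrow>\<^sup>*\<^bsub>G\<^esub> v"
    and "s \<in> S"
  shows "pre_digraph.scc_of G s = S"
proof -
  interpret wf_digraph G by fact
  have "v \<in> S" if "s \<rightarrow>\<^sup>*\<^bsub>G\<^esub> v" for v
    using that by (induction rule: reachable_induct) (use \<open>s \<in> S\<close> closed in auto)
  then show ?thesis
    using connected \<open>s \<in> S\<close> by (auto simp: scc_of_def)
qed

text \<open>
  An arc of \<open>G(\<Phi>)\<close> is an ordered pair of vertices together with an index below the
  multiplicity, so numbering the parallel arcs of \<open>D\<close> separately for each pair of ends gives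
  the bijection.
\<close>

lemma same_digraph_poly_digraphI:
  fixes D :: "(complex, 'e) pre_digraph"
  assumes "fin_digraph D"
    and mult: "\<And>u v. u \<in> verts D \<Longrightarrow> v \<in> verts D \<Longrightarrow>
      arc_mult \<Phi> u v = card {e \<in> arcs D. tail D e = u \<and> head D e = v}"
  shows "same_digraph D (poly_digraph \<Phi> \<restriction> verts D)"
proof -
  interpret fin_digraph D by fact
  define F where "F u v = {e \<in> arcs D. tail D e = u \<and> head D e = v}" for u v
  have "\<forall>u v. \<exists>h. bij_betw h (F u v) {0..<card (F u v)}"
    by (intro allI ex_bij_betw_finite_nat) (simp add: F_def)
  then obtain h where h: "\<And>u v. bij_betw (h u v) (F u v) {0..<card (F u v)}"
    by metis
  define f where "f e = (tail D e, head D e, h (tail D e) (head D e) e)" for e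
  have arcs_eq: "arcs (poly_digraph \<Phi> \<restriction> verts D) =
      {(u, v, i). u \<in> verts D \<and> v \<in> verts D \<and> i < card (F u v)}"
    using mult by (auto simp: poly_digraph_def F_def)
  have "bij_betw f (arcs D) (arcs (poly_digraph \<Phi> \<restriction> verts D))"
    unfolding bij_betw_def
  proof
    show "inj_on f (arcs D)"
    proof (rule inj_onI)
      fix a b assume ab: "a \<in> arcs D" "b \<in> arcs D" "f a = f b"
      then have "a \<in> F (tail D a) (head D a)" "b \<in> F (tail D a) (head D a)"
        "h (tail D a) (head D a) a = h (tail D a) (head D a) b"
        by (auto simp: F_def f_def)
      then show "a = b"
        using h[of "tail D a" "head D a"] by (auto simp: bij_betw_def inj_on_def)
    qed
    show "f ` arcs D = arcs (poly_digraph \<Phi> \<restriction> verts D)"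
    proof (intro equalityI subsetI)
      fix x assume "x \<in> f ` arcs D"
      then obtain e where e: "e \<in> arcs D" "x = f e" by blast
      then have "h (tail D e) (head D e) e < card (F (tail D e) (head D e))"
        using bij_betw_apply[OF h, of e "tail D e" "head D e"] by (simp add: F_def)
      with e show "x \<in> arcs (poly_digraph \<Phi> \<restriction> verts D)"
        unfolding arcs_eq by (simp add: f_def)
    next
      fix x assume "x \<in> arcs (poly_digraph \<Phi> \<restriction> verts D)"
      then obtain u v i where x: "x = (u, v, i)" "i < card (F u v)"
        unfolding arcs_eq by auto
      then have "i \<in> h u v ` F u v"
        using h[of u v] by (auto simp: bij_betw_def)
      then show "x \<in> f ` arcs D"
        using x by (force simp: F_def f_def)
    qed
  qed
  moreover have "tail (poly_digraph \<Phi> \<restriction> verts D) (f e) = tail D e \<and>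
      head (poly_digraph \<Phi> \<restriction> verts D) (f e) = head D e" for e
    by (simp add: induce_subgraph_def poly_digraph_def f_def)
  ultimately show ?thesis
    unfolding same_digraph_def by auto
qed

theorem theorem3:
  fixes D :: "(complex, 'e) pre_digraph" and d n :: nat
  assumes "fin_digraph D"
    and "strongly_connected D"
    and "regular_digraph d D"
    and "card (verts D) = n" and "n \<ge> 2"
  shows "\<exists>\<Phi> :: complex poly poly. is_strong_component D (poly_digraph \<Phi>)"
proof -
  interpret D: fin_digraph D by fact
  define P where "P u = (\<Prod>e\<in>out_arcs D u. [:- head D e, 1:])" for u
  obtain \<Phi> where \<Phi>: "\<And>u. u \<in> verts D \<Longrightarrow> poly \<Phi> [:u:] = P u"
    using interpolation_in_outer_variable[OF D.finite_verts, of P] by blast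
  have mult: "arc_mult \<Phi> u v = card {e \<in> arcs D. tail D e = u \<and> head D e = v}"
    if "u \<in> verts D" for u v
  proof -
    have fin: "finite (out_arcs D u)"
      by (simp add: out_arcs_def)
    have "arc_mult \<Phi> u v = order v (P u)"
      using fin by (simp add: arc_mult_def \<Phi> that P_def)
    also have "\<dots> = card {e \<in> out_arcs D u. head D e = v}"
      unfolding P_def by (rule order_prod_linear_factors[OF fin])
    finally show ?thesis
      by (simp add: out_arcs_def)
  qed
  \<comment> \<open>Here \<open>v\<close> ranges over all of \<open>\<complex>\<close>, so this also says that no arc leaves \<open>verts D\<close>.\<close>
  have dominates_iff: "u \<rightarrow>\<^bsub>poly_digraph \<Phi>\<^esub> v \<longleftrightarrow> u \<rightarrow>\<^bsub>D\<^esub> v" if "u \<in> verts D" for u v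
  proof -
    have "u \<rightarrow>\<^bsub>poly_digraph \<Phi>\<^esub> v \<longleftrightarrow> {e \<in> arcs D. tail D e = u \<and> head D e = v} \<noteq> {}"
      by (simp add: poly_digraph_dominates_iff mult that card_gt_0_iff)
    also have "\<dots> \<longleftrightarrow> u \<rightarrow>\<^bsub>D\<^esub> v"
      by (auto simp: arcs_ends_conv image_iff)
    finally show ?thesis .
  qed
  have "arcs_ends D \<subseteq> arcs_ends (poly_digraph \<Phi>)"
    using dominates_iff D.adj_in_verts(1) by auto
  then have reach: "u \<rightarrow>\<^sup>*\<^bsub>poly_digraph \<Phi>\<^esub> v" if "u \<rightarrow>\<^sup>*\<^bsub>D\<^esub> v" for u v
    using that rtrancl_on_mono[of "arcs_ends D" "arcs_ends (poly_digraph \<Phi>)"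
        "verts D" "verts (poly_digraph \<Phi>)"]
    by (auto simp: reachable_def poly_digraph_def)
  obtain s where s: "s \<in> verts D"
    using \<open>strongly_connected D\<close> by (auto simp: strongly_connected_def)
  have "pre_digraph.scc_of (poly_digraph \<Phi>) s = verts D"
  proof (rule scc_of_closed_set[OF wf_digraph_poly_digraph _ _ s])
    fix u v assume "u \<in> verts D" "u \<rightarrow>\<^bsub>poly_digraph \<Phi>\<^esub> v"
    then show "v \<in> verts D"
      using dominates_iff D.adj_in_verts(2) by blast
  next
    fix u v assume "u \<in> verts D" "v \<in> verts D"
    then show "u \<rightarrow>\<^sup>*\<^bsub>poly_digraph \<Phi>\<^esub> v"
      using \<open>strongly_connected D\<close> reach by (simp add: strongly_connected_def)
  qed
  moreover have "same_digraph D (poly_digraph \<Phi> \<restriction> verts D)"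
    using mult by (intro same_digraph_poly_digraphI \<open>fin_digraph D\<close>)
  ultimately have "is_strong_component D (poly_digraph \<Phi>)"
    unfolding is_strong_component_def strong_component_def
    by (intro bexI[of _ s]) (simp_all add: poly_digraph_def)
  then show ?thesis by blast
qed

end
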